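(* Let $n,m,q\ge 1$ and $r\ge 0$ be integers, let $A\in\mathbb{R}^{n\times n}$, $B_u\in\mathbb{R}^{n\times m}$, $B_\omega\in\mathbb{R}^{n\times q}$, and let $h\ge 0$, $T\ge 0$, $\epsilon_r\ge 0$, $t\in\mathbb{R}$. Assume: (1) $\omega:\mathbb{R}\to\mathbb{R}^q$ is $(r+1)$-times continuously differentiable with $\|\omega^{(r+1)}(s)\|\le\epsilon_r$ for all $s\in\mathbb{R}$; (2) $u:[t-h,t+T-h]\to\mathbb{R}^m$ is piecewise constant: there are $N\in\mathbb{N}$ ($N\ge 1$), time instants $t-h<t_1<t_2<\dots<t_N<t+T-h$ and vectors $u_0,\dots,u_N\in\mathbb{R}^m$ such that $u(\phi)=u_0$ for $\phi\in[t-h,t_1)$, $u(\phi)=u_k$ for $\phi\in[t_k,t_{k+1})$ with $1\le k\le N-1$, and $u(\phi)=u_N$ for $\phi\in[t_N,t+T-h]$. Let $x:[t,t+T]\to\mathbb{R}^n$ be the state of the system $\dot x(s)=Ax(s)+B_uu(s-h)+B_\omega\omega(s)$ (a continuous function satisfying the equation at all $s\in[t,t+T]$ except possibly the jump instants $t_k+h$). Let $\hat x(t)\in\mathbb{R}^n$ and $\hat{\boldsymbol{\omega}}_r(t)\in\mathbb{R}^{(r+1)q}$ be any vectors (observations of $x(t)$ and $\boldsymbol{\omega}_r(t)$, respectively), and define the prediction of $x(t+T)$ by $$\hat x(t+T)=\Phi(T)\hat x(t)+\boldsymbol{\Gamma}_\omega(T)\,\hat{\boldsymbol{\omega}}_r(t)+\boldsymbol{\Gamma}_u\,\boldsymbol{u}_{0-N}.$$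 Then the prediction error is $$x(t+T)-\hat x(t+T)=\mathcal{O}_e(t)+\mathcal{O}_r(t),$$ where $$\mathcal{O}_e(t)=\Phi(T)\,[x(t)-\hat x(t)]+\boldsymbol{\Gamma}_\omega(T)\,[\boldsymbol{\omega}_r(t)-\hat{\boldsymbol{\omega}}_r(t)],$$ $$\mathcal{O}_r(t)=\int_t^{t+T}\frac{(t+T-s)^{r+1}}{(r+1)!}\,\Gamma_{\omega,r}(t+T-s)B_\omega\,\omega^{(r+1)}(s)\,ds .$$
   Context: Notation. $\Phi(T)=e^{AT}$. $\boldsymbol{\omega}_r(t)=[\omega(t)^T,\dot\omega(t)^T,\dots,\omega^{(r)}(t)^T]^T\in\mathbb{R}^{(r+1)q}$ is the stacked vector of the disturbance and its first $r$ derivatives. $\boldsymbol{u}_{0-N}=[u_0^T,u_1^T,\dots,u_N^T]^T$. For $i=0,\dots,r$ and $\tau\in\mathbb{R}$: $\Gamma_{\omega,i}(\tau)=\sum_{j=0}^\infty\frac{(i+1)!}{(i+1+j)!}A^j\tau^j$, and $$\boldsymbol{\Gamma}_\omega(T)=\Big[\,T\,\Gamma_{\omega,0}(T)B_\omega,\ \dots,\ \tfrac{T^{r+1}}{(r+1)!}\Gamma_{\omega,r}(T)B_\omega\Big]\in\mathbb{R}^{n\times(r+1)q},$$ whose $i$-th block ($i=0,\dots,r$) is $\frac{T^{i+1}}{(i+1)!}\Gamma_{\omega,i}(T)B_\omega$. For $\alpha\le\beta\le t+T$: $$\Gamma_u(\alpha,\beta)=\int_\alpha^\beta e^{A(t+T-s)}B_u\,ds=\sum_{j=1}^\infty\Big[\tfrac{(t+T-\alpha)^j-(t+T-\beta)^j}{j!}A^{j-1}\Big]B_u,$$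 and $$\boldsymbol{\Gamma}_u=\big[\Gamma_u(t,t_1+h),\ \Gamma_u(t_1+h,t_2+h),\ \dots,\ \Gamma_u(t_{N-1}+h,t_N+h),\ \Gamma_u(t_N+h,t+T)\big].$$ *)

theory Defs
  imports "HOL-Analysis.Analysis"
begin

text \<open>
  On \<open>real ^ 'n ^ 'n\<close> the type-class product and power are componentwise, so matrix powers
  are iterated with \<open>**\<close>, and neither \<open>A ^ k\<close> nor \<open>exp\<close> can be used.
\<close>

definition matpow :: "real ^ 'n ^ 'n \<Rightarrow> nat \<Rightarrow> real ^ 'n ^ 'n" where
  "matpow A k = ((\<lambda>M. A ** M) ^^ k) (mat 1)"

definition matexp :: "real ^ 'n ^ 'n \<Rightarrow> real ^ 'n ^ 'n" where
  "matexp A = (\<Sum>k. (1 / fact k) *\<^sub>R matpow A k)"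

definition Phi :: "real ^ 'n ^ 'n \<Rightarrow> real \<Rightarrow> real ^ 'n ^ 'n" where
  "Phi A \<tau> = matexp (\<tau> *\<^sub>R A)"

primrec nth_vderiv :: "nat \<Rightarrow> (real \<Rightarrow> 'a::real_normed_vector) \<Rightarrow> real \<Rightarrow> 'a" where
  "nth_vderiv 0 f = f"
| "nth_vderiv (Suc k) f = (\<lambda>s. vector_derivative (nth_vderiv k f) (at s))"

definition times_cont_diff :: "nat \<Rightarrow> (real \<Rightarrow> 'a::real_normed_vector) \<Rightarrow> bool" where
  "times_cont_diff k f \<longleftrightarrow>
     (\<forall>i<k. \<forall>s. nth_vderiv i f differentiable (at s)) \<and>
     continuous_on UNIV (nth_vderiv k f)"

text \<open>
  The number of blocks of a stacked vector is a natural number, not a type.  A vector in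
  \<open>R^(K p)\<close> made of \<open>K\<close> blocks of size \<open>p = CARD('p)\<close> is a function on \<open>nat\<close> whose relevant
  values are those at \<open>0, ..., K - 1\<close>; a matrix made of \<open>K\<close> horizontally juxtaposed blocks is
  encoded likewise.
\<close>

definition block_mult ::
    "nat \<Rightarrow> (nat \<Rightarrow> real ^ 'p ^ 'n) \<Rightarrow> (nat \<Rightarrow> real ^ 'p) \<Rightarrow> real ^ 'n" where
  "block_mult K M v = (\<Sum>i<K. M i *v v i)"

definition stacked_derivs :: "(real \<Rightarrow> real ^ 'q) \<Rightarrow> real \<Rightarrow> nat \<Rightarrow> real ^ 'q" where
  "stacked_derivs \<omega> t = (\<lambda>i. nth_vderiv i \<omega> t)"

definition Gamma_w :: "real ^ 'n ^ 'n \<Rightarrow> nat \<Rightarrow> real \<Rightarrow> real ^ 'n ^ 'n" where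
  "Gamma_w A i \<tau> = (\<Sum>j. (fact (i + 1) / fact (i + 1 + j)) *\<^sub>R (\<tau> ^ j *\<^sub>R matpow A j))"

definition Gamma_w_blocks ::
    "real ^ 'n ^ 'n \<Rightarrow> real ^ 'q ^ 'n \<Rightarrow> real \<Rightarrow> nat \<Rightarrow> real ^ 'q ^ 'n" where
  "Gamma_w_blocks A B\<omega> T = (\<lambda>i. (T ^ (i + 1) / fact (i + 1)) *\<^sub>R (Gamma_w A i T ** B\<omega>))"

definition Gamma_u ::
    "real ^ 'n ^ 'n \<Rightarrow> real ^ 'm ^ 'n \<Rightarrow> real \<Rightarrow> real \<Rightarrow> real \<Rightarrow> real \<Rightarrow> real ^ 'm ^ 'n" where
  "Gamma_u A Bu t T \<alpha> \<beta> = integral {\<alpha>..\<beta>} (\<lambda>s. Phi A (t + T - s) ** Bu)"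

text \<open>
  The jump instants of the input are \<open>tj 1 < ... < tj N\<close>.  The input value \<open>k\<close> acts on the
  state from \<open>input_node k\<close> to \<open>input_node (k + 1)\<close>; these nodes are
  \<open>t, tj 1 + h, ..., tj N + h, t + T\<close>.
\<close>

definition input_node ::
    "real \<Rightarrow> real \<Rightarrow> real \<Rightarrow> nat \<Rightarrow> (nat \<Rightarrow> real) \<Rightarrow> nat \<Rightarrow> real" where
  "input_node t T h N tj k = (if k = 0 then t else if k \<le> N then tj k + h else t + T)"

definition Gamma_u_blocks ::
    "real ^ 'n ^ 'n \<Rightarrow> real ^ 'm ^ 'n \<Rightarrow> real \<Rightarrow> real \<Rightarrow> real \<Rightarrow> nat \<Rightarrow> (nat \<Rightarrow> real) \<Rightarrow>
      nat \<Rightarrow> real ^ 'm ^ 'n" where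
  "Gamma_u_blocks A Bu t T h N tj =
     (\<lambda>k. Gamma_u A Bu t T (input_node t T h N tj k) (input_node t T h N tj (k + 1)))"

end

theory Submission
  imports Defs
begin

text \<open>
  Put \<open>G\<^sub>i(\<tau>) = (\<Sum>j. \<tau>^(i+j) / (i+j)! A^j)\<close>.  Then \<open>G\<^sub>0 = \<Phi>\<close>, \<open>G\<^sub>0' = G\<^sub>0 A\<close>, \<open>G\<^sub>i\<^sub>+\<^sub>1' = G\<^sub>i\<close>, and
  \<open>G\<^sub>i\<^sub>+\<^sub>1(\<tau>) = \<tau>^(i+1) / (i+1)! \<Gamma>\<^sub>\<omega>\<^sub>,\<^sub>i(\<tau>)\<close>.  With \<open>c = t + T\<close>, the derivative of
  \<open>F(s) = G\<^sub>0(c-s) x(s) + (\<Sum>i\<le>r. G\<^sub>i\<^sub>+\<^sub>1(c-s) B\<^sub>\<omega> \<omega>\<^sup>(\<^sup>i\<^sup>)(s))\<close> telescopes to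
  \<open>G\<^sub>0(c-s) B\<^sub>u u(s-h) + G\<^sub>r\<^sub>+\<^sub>1(c-s) B\<^sub>\<omega> \<omega>\<^sup>(\<^sup>r\<^sup>+\<^sup>1\<^sup>)(s)\<close> off the jump instants, while \<open>F(c) = x(c)\<close> and
  \<open>F(t)\<close> is the prediction from exact data without the input term.  Integrating over
  \<open>[t, c]\<close> gives the claim.
\<close>

section \<open>Matrix products as bounded bilinear maps\<close>

lemma bounded_bilinear_matrix_vector_mult:
  "bounded_bilinear ((*v) :: real ^ 'n ^ 'm \<Rightarrow> real ^ 'n \<Rightarrow> real ^ 'm)"
  unfolding bilinear_conv_bounded_bilinear[symmetric] bilinear_def
  by (auto intro!: linearI simp: algebra_simps scaleR_matrix_vector_assoc)

text \<open>In finite dimension bilinearity already gives boundedness. Boundedness gives the product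
  rule and lets a fixed factor pass through series, derivatives and integrals.\<close>

lemma bounded_bilinear_matrix_matrix_mult:
  "bounded_bilinear ((**) :: real ^ 'n ^ 'm \<Rightarrow> real ^ 'p ^ 'n \<Rightarrow> real ^ 'p ^ 'm)"
  unfolding bilinear_conv_bounded_bilinear[symmetric] bilinear_def
  by (auto intro!: linearI
      simp: vec_eq_iff matrix_matrix_mult_def sum.distrib sum_distrib_left algebra_simps)

subsection \<open>Exponential generating functions\<close>

text \<open>Geometric growth makes \<open>egf b\<close> converge everywhere. Requiring
  \<open>K \<ge> 1\<close> makes the bound monotone in \<open>n\<close>, so that it survives
  delaying the sequence.\<close>

definition exp_bounded :: "(nat \<Rightarrow> 'a::real_normed_vector) \<Rightarrow> bool" where
  "exp_bounded b \<longleftrightarrow> (\<exists>C K. C \<ge> 0 \<and> K \<ge> 1 \<and> (\<forall>n. norm (b n) \<le> C * K ^ n))"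

text \<open>With this normalisation, differentiating the function amounts to dropping the first
  coefficient.\<close>

definition egf :: "(nat \<Rightarrow> 'a::real_normed_vector) \<Rightarrow> real \<Rightarrow> 'a" where
  "egf b \<tau> = (\<Sum>n. (\<tau> ^ n / fact n) *\<^sub>R b n)"

lemma exp_bounded_Suc:
  assumes "exp_bounded b"
  shows "exp_bounded (\<lambda>n. b (Suc n))"
proof -
  obtain C K where "C \<ge> 0" "K \<ge> 1" and b: "\<And>n. norm (b n) \<le> C * K ^ n"
    using assms by (auto simp: exp_bounded_def)
  have "norm (b (Suc n)) \<le> (C * K) * K ^ n" for n
    using b[of "Suc n"] by (simp add: mult.assoc)
  then show ?thesis
    unfolding exp_bounded_def using \<open>C \<ge> 0\<close> \<open>K \<ge> 1\<close>
    by (intro exI[of _ "C * K"] exI[of _ K]) auto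
qed

lemma exp_bounded_inner:
  assumes "exp_bounded b"
  shows "exp_bounded (\<lambda>n. b n \<bullet> e)"
proof -
  obtain C K where "C \<ge> 0" "K \<ge> 1" and b: "\<And>n. norm (b n) \<le> C * K ^ n"
    using assms by (auto simp: exp_bounded_def)
  have "norm (b n \<bullet> e) \<le> (C * norm e) * K ^ n" for n
  proof -
    have "norm (b n \<bullet> e) \<le> norm (b n) * norm e"
      using Cauchy_Schwarz_ineq2[of "b n" e] by simp
    also have "\<dots> \<le> (C * K ^ n) * norm e"
      by (intro mult_right_mono b) auto
    finally show ?thesis by (simp add: mult_ac)
  qed
  then show ?thesis
    unfolding exp_bounded_def using \<open>C \<ge> 0\<close> \<open>K \<ge> 1\<close>
    by (intro exI[of _ "C * norm e"] exI[of _ K]) auto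
qed

text \<open>The norms are dominated by the terms of the exponential series of
  \<open>\<bar>\<tau>\<bar> * K\<close>, scaled by \<open>C\<close>.\<close>

lemma summable_egf:
  fixes b :: "nat \<Rightarrow> 'a::banach"
  assumes "exp_bounded b"
  shows "summable (\<lambda>n. (\<tau> ^ n / fact n) *\<^sub>R b n)"
proof -
  obtain C K where K: "K \<ge> 1" and b: "\<And>n. norm (b n) \<le> C * K ^ n"
    using assms by (auto simp: exp_bounded_def)
  have "summable (\<lambda>n. C * (inverse (fact n) * (\<bar>\<tau>\<bar> * K) ^ n))"
    by (intro summable_mult summable_exp)
  then show ?thesis
  proof (rule summable_comparison_test')
    fix n :: nat
    have "norm ((\<tau> ^ n / fact n) *\<^sub>R b n) = \<bar>\<tau>\<bar> ^ n / fact n * norm (b n)"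
      by (simp add: power_abs)
    also have "\<dots> \<le> \<bar>\<tau>\<bar> ^ n / fact n * (C * K ^ n)"
      by (intro mult_left_mono b) auto
    finally show "norm ((\<tau> ^ n / fact n) *\<^sub>R b n) \<le> C * (inverse (fact n) * (\<bar>\<tau>\<bar> * K) ^ n)"
      by (simp add: power_mult_distrib field_simps)
  qed
qed

lemma egf_inner:
  fixes b :: "nat \<Rightarrow> 'a::euclidean_space"
  assumes "exp_bounded b"
  shows "egf b \<tau> \<bullet> e = egf (\<lambda>n. b n \<bullet> e) \<tau>"
  unfolding egf_def
  using bounded_linear.suminf[OF bounded_linear_inner_left[of e] summable_egf[OF assms, of \<tau>]]
  by simp

text \<open>Termwise differentiation of an everywhere convergent power series: the factor
  \<open>n + 1\<close> from \<open>diffs\<close> turns \<open>fact (Suc n)\<close> into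
  \<open>fact n\<close>.\<close>

lemma egf_has_real_derivative:
  fixes b :: "nat \<Rightarrow> real"
  assumes "exp_bounded b"
  shows "(egf b has_real_derivative egf (\<lambda>n. b (Suc n)) \<tau>) (at \<tau>)"
proof -
  define c where "c = (\<lambda>n. b n / fact n)"
  have "summable (\<lambda>n. c n * y ^ n)" for y
    using summable_egf[OF assms, of y] by (simp add: c_def mult.commute)
  then have "((\<lambda>x. \<Sum>n. c n * x ^ n) has_field_derivative (\<Sum>n. diffs c n * \<tau> ^ n)) (at \<tau>)"
    by (rule termdiffs_strong_converges_everywhere)
  moreover have "(\<lambda>x. \<Sum>n. c n * x ^ n) = egf b"
    by (simp add: egf_def c_def fun_eq_iff mult.commute)
  moreover have "diffs c n = b (Suc n) / fact n" for n
    by (simp add: diffs_def c_def del: of_nat_Suc)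
  ultimately show ?thesis
    by (simp add: egf_def mult.commute)
qed

text \<open>Taking inner products with basis vectors reduces this to the scalar case.\<close>

lemma egf_has_vector_derivative:
  fixes b :: "nat \<Rightarrow> 'a::euclidean_space"
  assumes "exp_bounded b"
  shows "(egf b has_vector_derivative egf (\<lambda>n. b (Suc n)) \<tau>) (at \<tau>)"
  unfolding has_vector_derivative_def
proof (subst has_derivative_componentwise_within, intro ballI)
  fix e :: 'a
  have "((\<lambda>\<tau>. egf (\<lambda>n. b n \<bullet> e) \<tau>) has_derivative
      (\<lambda>x. x *\<^sub>R egf (\<lambda>n. b (Suc n) \<bullet> e) \<tau>)) (at \<tau>)"
    using egf_has_real_derivative[OF exp_bounded_inner[OF assms], of e \<tau>]
    by (simp only: has_real_derivative_iff_has_vector_derivative has_vector_derivative_def)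
  then show "((\<lambda>\<tau>. egf b \<tau> \<bullet> e) has_derivative
      (\<lambda>x. (x *\<^sub>R egf (\<lambda>n. b (Suc n)) \<tau>) \<bullet> e)) (at \<tau>)"
    by (simp add: egf_inner[OF assms] egf_inner[OF exp_bounded_Suc[OF assms]])
qed

lemma egf_0: "egf b 0 = b 0"
proof -
  have "egf b 0 = (\<Sum>n\<in>{0}. (0 ^ n / fact n) *\<^sub>R b n)"
    unfolding egf_def by (rule suminf_finite) auto
  then show ?thesis by simp
qed

subsection \<open>Shifted matrix exponentials\<close>

lemma matpow_0: "matpow A 0 = mat 1"
  by (simp add: matpow_def)

lemma matpow_Suc: "matpow A (Suc k) = A ** matpow A k"
  by (simp add: matpow_def)

text \<open>\<open>matpow\<close> multiplies on the left; the derivative of \<open>Phi\<close> is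
  wanted with \<open>A\<close> on the right, next to the state, where it cancels the
  \<open>A\<close> of the differential equation.\<close>

lemma matpow_Suc_right: "matpow A (Suc k) = matpow A k ** A"
proof (induction k)
  case (Suc k)
  have "matpow A (Suc (Suc k)) = A ** (matpow A k ** A)"
    unfolding matpow_Suc[of A "Suc k"] Suc ..
  then show ?case
    unfolding matpow_Suc[of A k] matrix_mul_assoc .
qed (simp add: matpow_0 matpow_Suc)

lemma matpow_scaleR: "matpow (\<tau> *\<^sub>R A) k = \<tau> ^ k *\<^sub>R matpow A k"
  by (induction k)
    (simp_all add: matpow_0 matpow_Suc mult.commute
      bounded_bilinear.scaleR_left[OF bounded_bilinear_matrix_matrix_mult]
      bounded_bilinear.scaleR_right[OF bounded_bilinear_matrix_matrix_mult])

lemma exp_bounded_matpow: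
  fixes A :: "real ^ 'n ^ 'n"
  shows "exp_bounded (matpow A)"
proof -
  obtain K where "K > 0" and K: "\<And>M :: real ^ 'n ^ 'n. norm (A ** M) \<le> norm M * K"
    using bounded_linear.pos_bounded[OF
        bounded_bilinear.bounded_linear_right[OF bounded_bilinear_matrix_matrix_mult, of A]]
    by blast
  \<comment> \<open>\<open>K\<close> bounds left multiplication by \<open>A\<close> but may lie
    below 1, which \<open>exp_bounded\<close> does not allow as a base.\<close>
  define L where "L = max 1 K"
  have "norm (matpow A k) \<le> norm (mat 1 :: real ^ 'n ^ 'n) * L ^ k" for k
  proof (induction k)
    case 0
    then show ?case by (simp add: matpow_0)
  next
    case (Suc k)
    have "norm (matpow A (Suc k)) \<le> norm (matpow A k) * K"
      by (simp add: matpow_Suc K)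
    also have "\<dots> \<le> (norm (mat 1 :: real ^ 'n ^ 'n) * L ^ k) * L"
      using \<open>K > 0\<close> by (intro mult_mono Suc) (auto simp: L_def)
    finally show ?case by (simp add: mult_ac)
  qed
  then show ?thesis
    unfolding exp_bounded_def by (intro exI[of _ "norm (mat 1)"] exI[of _ L]) (auto simp: L_def)
qed

text \<open>Prepending \<open>i\<close> zeros to the coefficients integrates the generating function
  \<open>i\<close> times from 0.\<close>

definition shift :: "nat \<Rightarrow> (nat \<Rightarrow> 'a::zero) \<Rightarrow> nat \<Rightarrow> 'a" where
  "shift i a n = (if n < i then 0 else a (n - i))"

lemma exp_bounded_shift:
  assumes "exp_bounded a"
  shows "exp_bounded (shift i a)"
proof -
  obtain C K where "C \<ge> 0" "K \<ge> 1" and a: "\<And>n. norm (a n) \<le> C * K ^ n"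
    using assms by (auto simp: exp_bounded_def)
  have "norm (shift i a n) \<le> C * K ^ n" for n
  proof (cases "n < i")
    case True
    then show ?thesis using \<open>C \<ge> 0\<close> \<open>K \<ge> 1\<close> by (simp add: shift_def)
  next
    case False
    have "norm (a (n - i)) \<le> C * K ^ (n - i)" by (rule a)
    also have "\<dots> \<le> C * K ^ n"
      using \<open>C \<ge> 0\<close> \<open>K \<ge> 1\<close> by (intro mult_left_mono power_increasing) auto
    finally show ?thesis using False by (simp add: shift_def)
  qed
  then show ?thesis
    unfolding exp_bounded_def using \<open>C \<ge> 0\<close> \<open>K \<ge> 1\<close> by blast
qed

text \<open>This is the family \<open>G\<^sub>i\<close> of the opening comment, the matrix form of
  the phi-functions of exponential integrators, multiplied by \<open>\<tau> ^ i\<close>.\<close>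

definition shifted_Phi :: "real ^ 'n ^ 'n \<Rightarrow> nat \<Rightarrow> real \<Rightarrow> real ^ 'n ^ 'n" where
  "shifted_Phi A i = egf (shift i (matpow A))"

lemma shifted_Phi_Suc_has_vector_derivative:
  "(shifted_Phi A (Suc i) has_vector_derivative shifted_Phi A i \<tau>) (at \<tau>)"
proof -
  have "(\<lambda>n. shift (Suc i) (matpow A) (Suc n)) = shift i (matpow A)"
    by (simp add: shift_def fun_eq_iff)
  then show ?thesis
    using egf_has_vector_derivative[OF exp_bounded_shift[OF exp_bounded_matpow], of "Suc i" A \<tau>]
    by (simp add: shifted_Phi_def)
qed

text \<open>No leading zero is left to drop, so the coefficients become
  \<open>matpow A n ** A\<close>, and the right factor comes out of the series by bounded
  linearity.\<close>

lemma shifted_Phi_0_has_vector_derivative: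
  "(shifted_Phi A 0 has_vector_derivative shifted_Phi A 0 \<tau> ** A) (at \<tau>)"
proof -
  have "egf (\<lambda>n. matpow A (Suc n)) \<tau> = egf (matpow A) \<tau> ** A"
    unfolding egf_def
      bounded_linear.suminf[OF
        bounded_bilinear.bounded_linear_left[OF bounded_bilinear_matrix_matrix_mult]
        summable_egf[OF exp_bounded_matpow]]
    by (simp add: matpow_Suc_right
        bounded_bilinear.scaleR_left[OF bounded_bilinear_matrix_matrix_mult])
  then show ?thesis
    using egf_has_vector_derivative[OF exp_bounded_matpow, of A \<tau>]
    by (simp add: shifted_Phi_def shift_def[abs_def])
qed

lemma Phi_eq_shifted_Phi: "Phi A \<tau> = shifted_Phi A 0 \<tau>"
  by (simp add: Phi_def matexp_def shifted_Phi_def egf_def shift_def matpow_scaleR)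

text \<open>The first \<open>i + 1\<close> coefficients on the right vanish; after reindexing, the
  scalar on the left cancels \<open>fact (i + 1)\<close> and raises the power of
  \<open>\<tau>\<close>.\<close>

lemma Gamma_w_eq_shifted_Phi:
  "(\<tau> ^ (i + 1) / fact (i + 1)) *\<^sub>R Gamma_w A i \<tau> = shifted_Phi A (i + 1) \<tau>"
proof -
  let ?f = "\<lambda>n. (\<tau> ^ n / fact n) *\<^sub>R shift (i + 1) (matpow A) n"
  let ?g = "\<lambda>j. (fact (i + 1) / fact (i + 1 + j)) *\<^sub>R (\<tau> ^ j *\<^sub>R matpow A j)"
  have summable_f: "summable ?f"
    by (intro summable_egf exp_bounded_shift exp_bounded_matpow)
  have fg: "(\<tau> ^ (i + 1) / fact (i + 1)) *\<^sub>R ?g j = ?f (j + (i + 1))" for j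
    by (simp add: shift_def power_add add_ac del: fact_Suc)
  have "shifted_Phi A (i + 1) \<tau> = (\<Sum>j. ?f (j + (i + 1))) + (\<Sum>n<i + 1. ?f n)"
    unfolding shifted_Phi_def egf_def by (rule suminf_split_initial_segment[OF summable_f])
  also have "(\<Sum>n<i + 1. ?f n) = 0"
    by (intro sum.neutral) (simp add: shift_def)
  finally have eq: "shifted_Phi A (i + 1) \<tau> = (\<Sum>j. (\<tau> ^ (i + 1) / fact (i + 1)) *\<^sub>R ?g j)"
    by (simp only: fg add_0_right)
  show ?thesis
  \<comment> \<open>At 0 both sides vanish. Elsewhere the scalar is invertible, so summability of
    the series in \<open>Gamma_w\<close> follows from that of the shifted series.\<close>
  proof (cases "\<tau> = 0")
    case True
    then show ?thesis
      by (simp add: shifted_Phi_def egf_0 shift_def)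
  next
    case False
    define a where "a = \<tau> ^ (i + 1) / fact (i + 1)"
    have "a \<noteq> 0" using False by (simp add: a_def)
    have "summable (\<lambda>j. a *\<^sub>R ?g j)"
      unfolding fg a_def using summable_f by (rule summable_ignore_initial_segment)
    then have "summable (\<lambda>j. inverse a *\<^sub>R (a *\<^sub>R ?g j))"
      by (rule bounded_linear.summable[OF bounded_linear_scaleR_right])
    then have "summable ?g"
      unfolding scaleR_scaleR[of "inverse a" a] left_inverse[OF \<open>a \<noteq> 0\<close>] scaleR_one .
    then show ?thesis
      unfolding eq Gamma_w_def by (rule bounded_linear.suminf[OF bounded_linear_scaleR_right])
  qed
qed

lemma shifted_Phi_0_right: "shifted_Phi A i 0 = (if i = 0 then mat 1 else 0)"
  by (simp add: shifted_Phi_def egf_0 shift_def matpow_0)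

lemma continuous_on_shifted_Phi: "continuous_on S (shifted_Phi A i)"
proof (intro continuous_at_imp_continuous_on ballI)
  fix \<tau>
  show "isCont (shifted_Phi A i) \<tau>"
    using has_vector_derivative_continuous shifted_Phi_0_has_vector_derivative
      shifted_Phi_Suc_has_vector_derivative by (cases i) blast+
qed

lemma shifted_Phi_reflected_has_vector_derivative:
  "((\<lambda>s. shifted_Phi A i (c - s)) has_vector_derivative
     - (if i = 0 then shifted_Phi A 0 (c - s) ** A else shifted_Phi A (i - 1) (c - s))) (at s)"
proof -
  have refl: "((\<lambda>s. c - s) has_vector_derivative - 1) (at s)"
    by (auto intro!: derivative_eq_intros)
  have "(shifted_Phi A i has_vector_derivative
     (if i = 0 then shifted_Phi A 0 \<tau> ** A else shifted_Phi A (i - 1) \<tau>)) (at \<tau>)" for \<tau>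
    using shifted_Phi_0_has_vector_derivative shifted_Phi_Suc_has_vector_derivative
    by (cases i) auto
  from vector_diff_chain_at[OF refl this] show ?thesis
    by (simp add: o_def)
qed

subsection \<open>The prediction error\<close>

lemma has_integral_sum_pieces:
  fixes f :: "real \<Rightarrow> 'a::banach"
  assumes mono: "\<And>k. k < K \<Longrightarrow> p k \<le> p (Suc k)"
    and int: "\<And>k. k < K \<Longrightarrow> (f has_integral I k) {p k..p (Suc k)}"
  shows "(f has_integral (\<Sum>k<K. I k)) {p 0..p K}"
proof -
  \<comment> \<open>The inequality is carried through the induction because gluing two integrals
    needs ordered endpoints.\<close>
  have "p 0 \<le> p j \<and> (f has_integral (\<Sum>k<j. I k)) {p 0..p j}" if "j \<le> K" for j
    using that
  proof (induction j)
    case 0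
    have "(f has_integral 0) {p 0..p 0}"
      using has_integral_refl(2)[of f "p 0"] by (simp only: atLeastAtMost_singleton)
    then show ?case by (simp only: lessThan_0 sum.empty order_refl simp_thms)
  next
    case (Suc j)
    then have le: "p 0 \<le> p j" "p j \<le> p (Suc j)"
      and ints: "(f has_integral (\<Sum>k<j. I k)) {p 0..p j}" "(f has_integral I j) {p j..p (Suc j)}"
      by (simp_all add: mono int)
    have "(f has_integral (\<Sum>k<Suc j. I k)) {p 0..p (Suc j)}"
      unfolding sum.lessThan_Suc by (rule has_integral_combine[OF le ints])
    with le show ?case by simp
  qed
  then show ?thesis by blast
qed

text \<open>Between consecutive nodes the delayed input is a constant vector, which comes out of the
  integral by linearity and leaves a block \<open>Gamma_u\<close>.\<close>

lemma has_integral_piecewise_constant_input: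
  fixes A :: "real ^ 'n ^ 'n" and Bu :: "real ^ 'm ^ 'n" and u :: "real \<Rightarrow> real ^ 'm"
  assumes "N \<ge> 1" and t1: "t - h < tj 1"
    and incr: "\<And>k. 1 \<le> k \<Longrightarrow> k < N \<Longrightarrow> tj k < tj (k + 1)"
    and tN: "tj N < t + T - h"
    and u0: "\<And>\<phi>. \<phi> \<in> {t - h..<tj 1} \<Longrightarrow> u \<phi> = uval 0"
    and uk: "\<And>k \<phi>. 1 \<le> k \<Longrightarrow> k < N \<Longrightarrow> \<phi> \<in> {tj k..<tj (k + 1)} \<Longrightarrow> u \<phi> = uval k"
    and uN: "\<And>\<phi>. \<phi> \<in> {tj N..t + T - h} \<Longrightarrow> u \<phi> = uval N"
  shows "((\<lambda>s. (Phi A (t + T - s) ** Bu) *v u (s - h)) has_integral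
      block_mult (N + 1) (Gamma_u_blocks A Bu t T h N tj) uval) {t..t + T}"
proof -
  define p where "p = input_node t T h N tj"
  have p_ends: "p 0 = t" "p (N + 1) = t + T"
    by (simp_all add: p_def input_node_def)
  have p_le: "p k \<le> p (Suc k)" if k: "k < N + 1" for k
  proof -
    consider "k = 0" | "1 \<le> k" "k < N" | "k = N" using k by linarith
    then show ?thesis
      using \<open>N \<ge> 1\<close> t1 incr[of k] tN by cases (auto simp: p_def input_node_def)
  qed
  \<comment> \<open>The right end of each piece is excluded, since the input may already have jumped
    there; a single point does not affect the integral.\<close>
  have u_eq: "u (s - h) = uval k" 
    if k: "k < N + 1" and s: "s \<in> {p k..p (Suc k)} - {p (Suc k)}" for k s
  proof -
    consider "k = 0" | "1 \<le> k" "k < N" | "k = N" using k by linarith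
    then show ?thesis
    proof cases
      case 1
      then show ?thesis using s \<open>N \<ge> 1\<close> u0[of "s - h"] by (auto simp: p_def input_node_def)
    next
      case 2
      then show ?thesis using s by (intro uk) (auto simp: p_def input_node_def)
    next
      case 3
      then show ?thesis
        using s \<open>N \<ge> 1\<close> uN[of "s - h"] by (auto simp: p_def input_node_def)
    qed
  qed
  have "((\<lambda>s. (Phi A (t + T - s) ** Bu) *v u (s - h)) has_integral
      Gamma_u A Bu t T (p k) (p (Suc k)) *v uval k) {p k..p (Suc k)}" if "k < N + 1" for k
  proof (rule has_integral_spike_finite[where S = "{p (Suc k)}"])
    have "continuous_on {p k..p (Suc k)} (\<lambda>s. Phi A (t + T - s) ** Bu)"
      unfolding Phi_eq_shifted_Phi
      by (intro bounded_bilinear.continuous_on[OF bounded_bilinear_matrix_matrix_mult]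
          continuous_on_compose2[OF continuous_on_shifted_Phi[of UNIV]] continuous_intros) auto
    then have "((\<lambda>s. Phi A (t + T - s) ** Bu) has_integral
        Gamma_u A Bu t T (p k) (p (Suc k))) {p k..p (Suc k)}"
      unfolding Gamma_u_def by (intro integrable_integral integrable_continuous_real)
    then show "((\<lambda>s. (Phi A (t + T - s) ** Bu) *v uval k) has_integral
        Gamma_u A Bu t T (p k) (p (Suc k)) *v uval k) {p k..p (Suc k)}"
      by (rule has_integral_linear[unfolded o_def])
        (rule bounded_bilinear.bounded_linear_left[OF bounded_bilinear_matrix_vector_mult])
  qed (use u_eq[OF that] in auto)
  with p_le have "((\<lambda>s. (Phi A (t + T - s) ** Bu) *v u (s - h)) has_integral
      (\<Sum>k<N + 1. Gamma_u A Bu t T (p k) (p (Suc k)) *v uval k)) {p 0..p (N + 1)}"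
    by (rule has_integral_sum_pieces)
  then show ?thesis
    unfolding p_ends unfolding block_mult_def Gamma_u_blocks_def p_def Suc_eq_plus1 .
qed

lemma nth_vderiv_has_vector_derivative:
  assumes "times_cont_diff k f" "i < k"
  shows "(nth_vderiv i f has_vector_derivative nth_vderiv (Suc i) f s) (at s)"
  using assms by (simp add: times_cont_diff_def vector_derivative_works)

theorem theorem1:
  fixes A :: "real ^ 'n ^ 'n" and Bu :: "real ^ 'm ^ 'n" and B\<omega> :: "real ^ 'q ^ 'n"
    and h T \<epsilon>r t :: real and r N :: nat
    and \<omega> :: "real \<Rightarrow> real ^ 'q" and u :: "real \<Rightarrow> real ^ 'm" and x :: "real \<Rightarrow> real ^ 'n"
    and tj :: "nat \<Rightarrow> real" and uval :: "nat \<Rightarrow> real ^ 'm"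
    and xhat xpred Oe Or :: "real ^ 'n" and \<omega>hat :: "nat \<Rightarrow> real ^ 'q"
  assumes "h \<ge> 0" and "T \<ge> 0" and "\<epsilon>r \<ge> 0"
    and "times_cont_diff (r + 1) \<omega>"
    and "\<And>s. norm (nth_vderiv (r + 1) \<omega> s) \<le> \<epsilon>r"
    and "N \<ge> 1"
    and "t - h < tj 1"
    and "\<And>k. 1 \<le> k \<Longrightarrow> k < N \<Longrightarrow> tj k < tj (k + 1)"
    and "tj N < t + T - h"
    and "\<And>\<phi>. \<phi> \<in> {t - h..<tj 1} \<Longrightarrow> u \<phi> = uval 0"
    and "\<And>k \<phi>. 1 \<le> k \<Longrightarrow> k < N \<Longrightarrow> \<phi> \<in> {tj k..<tj (k + 1)} \<Longrightarrow> u \<phi> = uval k"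
    and "\<And>\<phi>. \<phi> \<in> {tj N..t + T - h} \<Longrightarrow> u \<phi> = uval N"
    and "continuous_on {t..t + T} x"
    and "\<And>s. s \<in> {t..t + T} - {tj k + h |k. 1 \<le> k \<and> k \<le> N} \<Longrightarrow>
           (x has_vector_derivative (A *v x s + Bu *v u (s - h) + B\<omega> *v \<omega> s))
             (at s within {t..t + T})"
    and "xpred = Phi A T *v xhat + block_mult (r + 1) (Gamma_w_blocks A B\<omega> T) \<omega>hat
           + block_mult (N + 1) (Gamma_u_blocks A Bu t T h N tj) uval"
    and "Oe = Phi A T *v (x t - xhat)
           + block_mult (r + 1) (Gamma_w_blocks A B\<omega> T) (\<lambda>i. stacked_derivs \<omega> t i - \<omega>hat i)"
    and "Or = integral {t..t + T}
           (\<lambda>s. ((t + T - s) ^ (r + 1) / fact (r + 1)) *\<^sub>R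
                 ((Gamma_w A r (t + T - s) ** B\<omega>) *v nth_vderiv (r + 1) \<omega> s))"
  shows "x (t + T) - xpred = Oe + Or"
proof -
  note [simp] = bounded_bilinear.minus_left[OF bounded_bilinear_matrix_vector_mult]
    bounded_bilinear.minus_left[OF bounded_bilinear_matrix_matrix_mult]
  define c where "c = t + T"
  define G where "G = (\<lambda>i s. shifted_Phi A i (c - s))"
  \<comment> \<open>\<open>W\<close> pairs equal indices, while \<open>V\<close> has
    \<open>G\<close> one index ahead. The product rule then gives \<open>W (Suc i) - W i\<close> as
    the derivative of \<open>V i\<close>, so the sum telescopes.\<close>
  define W where "W = (\<lambda>i s. (G i s ** B\<omega>) *v nth_vderiv i \<omega> s)"
  define V where "V = (\<lambda>i s. (G (Suc i) s ** B\<omega>) *v nth_vderiv i \<omega> s)"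
  define F where "F = (\<lambda>s. G 0 s *v x s + (\<Sum>i<r + 1. V i s))"
  define J where "J = {tj k + h |k. 1 \<le> k \<and> k \<le> N}"
  have c: "t \<le> c" using \<open>T \<ge> 0\<close> by (simp add: c_def)
  have "J = (\<lambda>k. tj k + h) ` {1..N}" by (auto simp: J_def)
  then have J: "finite J" by simp
  have G_cont: "continuous_on S (G i)" for S i
    unfolding G_def
    by (intro continuous_on_compose2[OF continuous_on_shifted_Phi[of UNIV]] continuous_intros) auto
  have V_deriv: "(V i has_vector_derivative (W (Suc i) s - W i s)) (at s)" if "i < r + 1" for i s
  proof -
    have "(G (Suc i) has_vector_derivative - G i s) (at s)"
      using shifted_Phi_reflected_has_vector_derivative[of A "Suc i" c s] by (simp add: G_def)
    then have "((\<lambda>s. G (Suc i) s ** B\<omega>) has_vector_derivative - G i s ** B\<omega>) (at s)"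
      by (rule bounded_linear.has_vector_derivative[OF
            bounded_bilinear.bounded_linear_left[OF bounded_bilinear_matrix_matrix_mult]])
    from bounded_bilinear.has_vector_derivative[OF bounded_bilinear_matrix_vector_mult this
        nth_vderiv_has_vector_derivative[OF assms(4) that]]
    show ?thesis
      by (simp add: V_def W_def del: nth_vderiv.simps)
  qed
  have F_deriv: "(F has_vector_derivative ((G 0 s ** Bu) *v u (s - h) + W (r + 1) s)) (at s)"
    if s: "s \<in> {t<..<c} - J" for s
  proof -
    have "(x has_vector_derivative (A *v x s + Bu *v u (s - h) + B\<omega> *v \<omega> s)) (at s within {t..c})"
      using s by (auto intro!: assms(14) simp: c_def J_def)
    \<comment> \<open>At an interior point the derivative within the interval is the two-sided
      one.\<close>
    then have x: "(x has_vector_derivative (A *v x s + Bu *v u (s - h) + B\<omega> *v \<omega> s)) (at s)"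
      using s at_within_interior[of s "{t..c}"] by simp
    have "(G 0 has_vector_derivative - (G 0 s ** A)) (at s)"
      using shifted_Phi_reflected_has_vector_derivative[of A 0 c s] by (simp add: G_def)
    note Gx = bounded_bilinear.has_vector_derivative[OF bounded_bilinear_matrix_vector_mult this x]
    have "((\<lambda>s. \<Sum>i<r + 1. V i s) has_vector_derivative (\<Sum>i<r + 1. W (Suc i) s - W i s)) (at s)"
      by (intro has_vector_derivative_sum V_deriv) simp
    then have "((\<lambda>s. \<Sum>i<r + 1. V i s) has_vector_derivative (W (r + 1) s - W 0 s)) (at s)"
      unfolding sum_lessThan_telescope[of "\<lambda>i. W i s"] .
    \<comment> \<open>The two terms containing \<open>A\<close> cancel, and \<open>- W 0 s\<close>
      cancels the disturbance term of the state equation.\<close>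
    from has_vector_derivative_add[OF Gx this] show ?thesis
      unfolding F_def
      by (simp add: W_def matrix_vector_mul_assoc[symmetric] matrix_vector_right_distrib
          del: nth_vderiv.simps(2))
  qed
  have "continuous_on {t..c} (V i)" if "i < r + 1" for i
    using V_deriv[OF that] has_vector_derivative_continuous
    by (intro continuous_at_imp_continuous_on) blast
  then have "continuous_on {t..c} F"
    unfolding F_def using assms(13) G_cont
    by (intro continuous_intros continuous_on_sum
        bounded_bilinear.continuous_on[OF bounded_bilinear_matrix_vector_mult])
      (auto simp: c_def)
  \<comment> \<open>Continuity of \<open>F\<close> on the closed interval allows the derivative to
    be missing at the endpoints and on the finite set \<open>J\<close>.\<close>
  from fundamental_theorem_of_calculus_interior_strong[OF J c F_deriv this]
  have "((\<lambda>s. (G 0 s ** Bu) *v u (s - h) + W (r + 1) s) has_integral F c - F t) {t..c}" .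
  moreover have "((\<lambda>s. (G 0 s ** Bu) *v u (s - h)) has_integral
      block_mult (N + 1) (Gamma_u_blocks A Bu t T h N tj) uval) {t..c}"
    using has_integral_piecewise_constant_input[where N = N and t = t and h = h and tj = tj and T = T
        and u = u and uval = uval and A = A and Bu = Bu, OF assms(6-12)]
    by (simp add: G_def c_def Phi_eq_shifted_Phi)
  moreover have "(W (r + 1) has_integral Or) {t..c}"
  proof -
    have W_eq: "W (r + 1) s = ((t + T - s) ^ (r + 1) / fact (r + 1)) *\<^sub>R
        ((Gamma_w A r (t + T - s) ** B\<omega>) *v nth_vderiv (r + 1) \<omega> s)" for s
      unfolding W_def G_def c_def Gamma_w_eq_shifted_Phi[symmetric]
      by (simp only: bounded_bilinear.scaleR_left[OF bounded_bilinear_matrix_matrix_mult]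
          bounded_bilinear.scaleR_left[OF bounded_bilinear_matrix_vector_mult])
    have "continuous_on {t..c} (nth_vderiv (r + 1) \<omega>)"
      using assms(4) continuous_on_subset[OF _ subset_UNIV] by (auto simp: times_cont_diff_def)
    then have "continuous_on {t..c} (W (r + 1))"
      unfolding W_def
      by (intro bounded_bilinear.continuous_on[OF bounded_bilinear_matrix_vector_mult]
          bounded_bilinear.continuous_on[OF bounded_bilinear_matrix_matrix_mult]
          G_cont continuous_intros)
    then have "(W (r + 1) has_integral integral {t..c} (W (r + 1))) {t..c}"
      by (intro integrable_integral integrable_continuous_real)
    also have "integral {t..c} (W (r + 1)) = Or"
      unfolding assms(17) W_eq[abs_def] by (simp add: c_def)
    finally show ?thesis .
  qed
  ultimately have F_diff:
    "F c - F t = block_mult (N + 1) (Gamma_u_blocks A Bu t T h N tj) uval + Or"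
    using has_integral_add has_integral_unique by blast
  \<comment> \<open>At argument 0, \<open>shifted_Phi\<close> is the identity for index 0 and zero
    for all others, so every \<open>V i\<close> vanishes.\<close>
  have F_c: "F c = x (t + T)"
    by (simp add: F_def V_def G_def shifted_Phi_0_right c_def
        bounded_bilinear.zero_left[OF bounded_bilinear_matrix_matrix_mult])
  have "Gamma_w_blocks A B\<omega> T i = G (Suc i) t ** B\<omega>" for i
    using Gamma_w_eq_shifted_Phi[of T i A]
    by (simp add: Gamma_w_blocks_def G_def c_def
        flip: bounded_bilinear.scaleR_left[OF bounded_bilinear_matrix_matrix_mult])
  then have F_t: "F t = Phi A T *v x t + block_mult (r + 1) (Gamma_w_blocks A B\<omega> T) (stacked_derivs \<omega> t)"
    by (simp add: F_def V_def block_mult_def stacked_derivs_def G_def c_def Phi_eq_shifted_Phi)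
  \<comment> \<open>Linearity splits the observation error, after which the input terms of
    \<open>F_diff\<close> and \<open>xpred\<close> cancel.\<close>
  have "block_mult (r + 1) (Gamma_w_blocks A B\<omega> T) (\<lambda>i. stacked_derivs \<omega> t i - \<omega>hat i) =
      block_mult (r + 1) (Gamma_w_blocks A B\<omega> T) (stacked_derivs \<omega> t)
      - block_mult (r + 1) (Gamma_w_blocks A B\<omega> T) \<omega>hat"
    by (simp add: block_mult_def matrix_vector_mult_diff_distrib sum_subtractf)
  then show ?thesis
    using F_diff unfolding F_c F_t assms(15,16)
    by (simp add: algebra_simps)
qed

end
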